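(* Let $n\ge 3$, let $\mathbb{K}$ be a field, let $\mathcal{A}=\mathbb{K}[x_0,x_1,\ldots,x_n,x_{n+1},\ldots,x_{2n}]$, and let $L=CNI(H_{0,2n})\subset\mathcal{A}$ be the closed neighborhood ideal of the Helm graph $H_{0,2n}$. Then the $v$-number of $L$ is $$v(L)=n.$$
   Context: For $n\ge 3$, the Helm graph $H_{0,2n}$ is the simple graph with vertex set $\{x_0,x_1,\ldots,x_n,x_{n+1},\ldots,x_{2n}\}$ and edge set $$E(C_n)\cup\{\{x_0,x_i\}:1\le i\le n\}\cup\{\{x_i,x_{n+i}\}:1\le i\le n\},$$ where $E(C_n)=\{\{x_i,x_{i+1}\}:1\le i\le n-1\}\cup\{\{x_n,x_1\}\}$. The closed neighborhood ideal $CNI(G)$ of a graph $G$ is the monomial ideal generated by the products $\prod_{x_j\in N[x_i]}x_j$ for $x_i\in V(G)$, where $N[x_i]=\{x_i\}\cup\{x_j:\{x_i,x_j\}\in E(G)\}$. For the Helm graph, $$L=CNI(H_{0,2n})=(x_1x_{n+1},\,x_2x_{n+2},\ldots,x_nx_{2n},\,x_0x_1x_2\cdots x_n).$$ The $v$-number of a monomial ideal $I\subseteq\mathcal{A}$ is $$v(I)=\min\{\deg(u) : u\text{ is a monomial of }\mathcal{A}\text{ and }(I:u)\in\operatorname{Ass}(\mathcal{A}/I)\},$$ where $\operatorname{Ass}(\mathcal{A}/I)$ is the set of associated primes of $\mathcal{A}/I$. *)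

theory Defs
  imports "HOL-Algebra.QuotRing" "HOL-Algebra.Module" "HOL-Library.Poly_Mapping"
begin

type_synonym ('v, 'k) mpoly = "('v \<Rightarrow>\<^sub>0 nat) \<Rightarrow>\<^sub>0 'k"

text \<open>The polynomial ring over the field \<open>'k\<close> in the variables \<open>Var v\<close>, \<open>v \<in> V\<close>. The type
  \<open>('v, 'k) mpoly\<close> has a variable for every element of \<open>'v\<close>, so the variables are cut down to
  \<open>V\<close> by the carrier. In a polynomial, \<open>keys\<close> are the exponent vectors of its terms.\<close>

definition poly_ring :: "'v set \<Rightarrow> ('v, 'k::field) mpoly ring" where
  "poly_ring V = \<lparr>carrier = {p. \<forall>m \<in> Poly_Mapping.keys p. Poly_Mapping.keys m \<subseteq> V},
     mult = (*), one = 1, zero = 0, add = (+)\<rparr>"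

definition monomial :: "('v \<Rightarrow>\<^sub>0 nat) \<Rightarrow> ('v, 'k::field) mpoly" where
  "monomial m = Poly_Mapping.single m 1"

definition monomial_deg :: "('v \<Rightarrow>\<^sub>0 nat) \<Rightarrow> nat" where
  "monomial_deg m = (\<Sum>v \<in> Poly_Mapping.keys m. Poly_Mapping.lookup m v)"

definition Var :: "'v \<Rightarrow> ('v, 'k::field) mpoly" where
  "Var v = monomial (Poly_Mapping.single v 1)"

lemma cring_poly_ring: "cring (poly_ring V :: ('v, 'k::field) mpoly ring)"
proof (rule cringI)
  let ?R = "poly_ring V :: ('v, 'k) mpoly ring"
  have add: "p + q \<in> carrier ?R" if "p \<in> carrier ?R" "q \<in> carrier ?R" for p q
    using that keys_add[of p q] by (auto simp: poly_ring_def)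
  have keys_plus: "Poly_Mapping.keys (a + b) \<subseteq> V"
    if "Poly_Mapping.keys a \<subseteq> V" "Poly_Mapping.keys b \<subseteq> V" for a b :: "'v \<Rightarrow>\<^sub>0 nat"
    using that keys_add[of a b] by blast
  have mult: "p * q \<in> carrier ?R" if "p \<in> carrier ?R" "q \<in> carrier ?R" for p q
  proof -
    have "Poly_Mapping.keys m \<subseteq> V" if m: "m \<in> Poly_Mapping.keys (p * q)" for m
    proof -
      obtain a b where "m = a + b" "a \<in> Poly_Mapping.keys p" "b \<in> Poly_Mapping.keys q"
        using keys_mult[of p q] m by auto
      then show ?thesis
        using keys_plus[of a b] \<open>p \<in> carrier ?R\<close> \<open>q \<in> carrier ?R\<close> by (simp add: poly_ring_def)
    qed
    then show ?thesis by (simp add: poly_ring_def)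
  qed
  have zero: "0 \<in> carrier ?R" and one: "1 \<in> carrier ?R"
    by (simp_all add: poly_ring_def)
  have uminus: "- p \<in> carrier ?R" if "p \<in> carrier ?R" for p
    using that by (simp add: poly_ring_def)
  have ops: "mult ?R = (*)" "one ?R = 1" "zero ?R = 0" "add ?R = (+)"
    by (simp_all add: poly_ring_def)
  show "abelian_group ?R"
  proof (rule abelian_groupI; (unfold ops)?)
    show "\<exists>y \<in> carrier ?R. y + x = 0" if "x \<in> carrier ?R" for x
      using uminus[OF that] by (intro bexI[of _ "- x"]) simp_all
  qed (simp_all add: add zero add.assoc add.commute)
  show "comm_monoid ?R"
    by (rule comm_monoidI; (unfold ops)?) (simp_all add: mult one mult.assoc mult.commute)
  show "(x \<oplus>\<^bsub>?R\<^esub> y) \<otimes>\<^bsub>?R\<^esub> z = x \<otimes>\<^bsub>?R\<^esub> z \<oplus>\<^bsub>?R\<^esub> y \<otimes>\<^bsub>?R\<^esub> z" for x y z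
    unfolding ops by (rule distrib_right)
qed

definition colon_ideal :: "('a, 'm) ring_scheme \<Rightarrow> 'a set \<Rightarrow> 'a \<Rightarrow> 'a set" where
  "colon_ideal R I u = {f \<in> carrier R. f \<otimes>\<^bsub>R\<^esub> u \<in> I}"

text \<open>\<open>R/I\<close> as an \<open>R\<close>-module. Its \<open>mult\<close> and \<open>one\<close> fields, which \<^locale>\<open>module\<close> ignores, are
  those of the quotient ring; a scalar acts through its coset.\<close>

definition quot_module :: "('a, 'm) ring_scheme \<Rightarrow> 'a set \<Rightarrow> ('a, 'a set) module" where
  "quot_module R I = \<lparr>carrier = carrier (R Quot I), mult = mult (R Quot I), one = one (R Quot I),
     zero = zero (R Quot I), add = add (R Quot I),
     smult = (\<lambda>r x. (I +>\<^bsub>R\<^esub> r) \<otimes>\<^bsub>R Quot I\<^esub> x)\<rparr>"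

lemma module_quot_module:
  assumes "ideal I R" "cring R"
  shows "module R (quot_module R I)"
proof -
  interpret I: ideal I R by fact
  interpret cring R by fact
  define Q where "Q = R Quot I"
  interpret Q: cring Q using I.quotient_is_cring[OF assms(2)] by (simp add: Q_def)
  interpret h: ring_hom_cring R Q "(+>\<^bsub>R\<^esub>) I"
    using I.rcos_ring_hom_cring[OF assms(2)] by (simp add: Q_def)
  let ?M = "quot_module R I"
  have M: "carrier ?M = carrier Q" "add ?M = add Q" "zero ?M = zero Q"
    "smult ?M = (\<lambda>r x. (I +>\<^bsub>R\<^esub> r) \<otimes>\<^bsub>Q\<^esub> x)"
    by (simp_all add: quot_module_def Q_def)
  have "abelian_group ?M"
  proof (rule abelian_groupI)
    show "\<exists>y \<in> carrier ?M. y \<oplus>\<^bsub>?M\<^esub> x = \<zero>\<^bsub>?M\<^esub>" if "x \<in> carrier ?M" for x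
      using that Q.add.l_inv_ex[of x] unfolding M by auto
  qed (unfold M, simp_all add: Q.a_ac)
  then show ?thesis
    by (intro moduleI assms; (unfold M)?) (simp_all add: Q.l_distr Q.r_distr Q.m_assoc)
qed

definition ann :: "('a, 'm) ring_scheme \<Rightarrow> ('a, 'b, 'n) module_scheme \<Rightarrow> 'b \<Rightarrow> 'a set" where
  "ann R M x = {r \<in> carrier R. r \<odot>\<^bsub>M\<^esub> x = \<zero>\<^bsub>M\<^esub>}"

definition Ass :: "('a, 'm) ring_scheme \<Rightarrow> ('a, 'b, 'n) module_scheme \<Rightarrow> 'a set set" where
  "Ass R M = {P. primeideal P R \<and> (\<exists>x \<in> carrier M. P = ann R M x)}"

text \<open>Degrees of monomials of \<open>K[Var v | v \<in> V]\<close>. On \<^typ>\<open>nat\<close>, \<open>Inf\<close> of a nonempty set is its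
  minimum, while \<open>Inf {} = 0\<close>; so a nonzero \<open>v_number\<close> is always attained.\<close>

definition v_number :: "'v set \<Rightarrow> ('v, 'k::field) mpoly set \<Rightarrow> nat" where
  "v_number V I = Inf {monomial_deg m | m. Poly_Mapping.keys m \<subseteq> V \<and>
     colon_ideal (poly_ring V) I (monomial m) \<in> Ass (poly_ring V) (quot_module (poly_ring V) I)}"

text \<open>A graph is given by its vertex set \<open>V\<close> and its set \<open>E\<close> of two-element edges.\<close>

definition closed_nbhd :: "'v set \<Rightarrow> 'v set set \<Rightarrow> 'v \<Rightarrow> 'v set" where
  "closed_nbhd V E v = insert v {w \<in> V. {v, w} \<in> E}"

definition CNI :: "'v set \<Rightarrow> 'v set set \<Rightarrow> ('v, 'k::field) mpoly set" where
  "CNI V E = Idl\<^bsub>poly_ring V\<^esub> {\<Prod>w \<in> closed_nbhd V E v. Var w | v. v \<in> V}"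

text \<open>The vertex \<open>i\<close> stands for \<open>x\<^sub>i\<close>: the hub is \<open>0\<close>, the rim \<open>1, \<dots>, n\<close>, the pendants
  \<open>n + 1, \<dots>, 2n\<close>.\<close>

definition helm_verts :: "nat \<Rightarrow> nat set" where
  "helm_verts n = {0..2 * n}"

definition helm_edges :: "nat \<Rightarrow> nat set set" where
  "helm_edges n = {{i, i + 1} | i. 1 \<le> i \<and> i < n} \<union> {{n, 1}}
     \<union> {{0, i} | i. 1 \<le> i \<and> i \<le> n} \<union> {{i, n + i} | i. 1 \<le> i \<and> i \<le> n}"

lemma helm_edges_simple:
  assumes "n \<ge> 3" "e \<in> helm_edges n"
  shows "e \<subseteq> helm_verts n" "card e = 2"
proof -
  from assms consider i where "e = {i, i + 1}" "1 \<le> i" "i < n" | "e = {n, 1}"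
    | i where "e = {0, i}" "1 \<le> i" "i \<le> n" | i where "e = {i, n + i}" "1 \<le> i" "i \<le> n"
    unfolding helm_edges_def by blast
  then have "e \<subseteq> helm_verts n \<and> card e = 2"
    by cases (use assms(1) in \<open>simp_all add: helm_verts_def card_insert_if\<close>)
  then show "e \<subseteq> helm_verts n" "card e = 2" by auto
qed

end

theory Submission
  imports Defs
begin

text \<open>Both bounds come from a combinatorial reading of the colon ideals. A squarefree monomial ideal
  \<open>I\<close> is given by a family \<open>F\<close> of variable sets: \<open>p \<in> I\<close> iff the support of every term of \<open>p\<close>
  contains a member of \<open>F\<close> (lemma \<open>genideal_squarefree\<close>). Dividing by a monomial \<open>u\<close> removes the
  support of \<open>u\<close> from all members of \<open>F\<close> (\<open>colon_squarefree_ideal\<close>), and a colon ideal \<open>(I : u)\<close> is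
  always the annihilator of the class of \<open>u\<close>, so it is an associated prime as soon as it is prime
  (\<open>colon_in_Ass_iff\<close>). For the Helm graph, \<open>F\<close> may be replaced by the rungs \<open>{i, n + i}\<close> together
  with \<open>{0, \<dots>, n}\<close>.

  Upper bound: \<open>u = x\<^bsub>n+1\<^esub> \<cdots> x\<^bsub>2n\<^esub>\<close> cuts each rung down to \<open>{i}\<close>, and these singletons absorb all
  other generators; so \<open>(L : u) = (x\<^sub>1, \<dots>, x\<^sub>n)\<close> is prime.

  Lower bound: let \<open>(L : u)\<close> be prime, with \<open>U\<close> the support of \<open>u\<close>. No generator lies within \<open>U\<close>.
  Each \<open>x\<^sub>i x\<^bsub>n+i\<^esub>\<close> is in \<open>L\<close>, hence one of \<open>x\<^sub>i\<close>, \<open>x\<^bsub>n+i\<^esub>\<close> is in \<open>(L : u)\<close>, that is, adding \<open>i\<close> or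
  \<open>n + i\<close> to \<open>U\<close> completes a generator. If this is the rung of \<open>i\<close>, then \<open>U\<close> meets that rung; if this
  happens for all \<open>i\<close>, then \<open>U\<close> has at least \<open>n\<close> elements because rungs are disjoint. Otherwise some
  \<open>i\<close> completes \<open>{0, \<dots>, n}\<close>, and \<open>U\<close> contains the other \<open>n\<close> of these \<open>n + 1\<close> elements.\<close>

section \<open>Supports of polynomials\<close>

lemma sum_single_keys:
  "p = (\<Sum>m\<in>Poly_Mapping.keys p. Poly_Mapping.single m (Poly_Mapping.lookup p m))"
  by (rule poly_mapping_eqI)
    (auto simp: lookup_sum lookup_single when_def not_in_keys_iff_lookup_eq_zero)

lemma keys_plus_nat:
  fixes a b :: "'v \<Rightarrow>\<^sub>0 nat"
  shows "Poly_Mapping.keys (a + b) = Poly_Mapping.keys a \<union> Poly_Mapping.keys b"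
  by (auto simp: in_keys_iff lookup_add)

lemma keys_times_monomial:
  fixes p :: "('v, 'k::field) mpoly"
  shows "Poly_Mapping.keys (p * monomial u) = (\<lambda>m. m + u) ` Poly_Mapping.keys p"
proof
  show "Poly_Mapping.keys (p * monomial u) \<subseteq> (\<lambda>m. m + u) ` Poly_Mapping.keys p"
    using keys_mult[of p "monomial u"] by (auto simp: monomial_def)
  have "p * monomial u = (\<Sum>m\<in>Poly_Mapping.keys p. Poly_Mapping.single (m + u) (Poly_Mapping.lookup p m))"
    by (subst sum_single_keys[of p]) (simp add: sum_distrib_right monomial_def mult_single)
  then have "Poly_Mapping.lookup (p * monomial u) (m + u) = Poly_Mapping.lookup p m" for m
    by (auto simp: lookup_sum lookup_single when_def not_in_keys_iff_lookup_eq_zero)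
  then show "(\<lambda>m. m + u) ` Poly_Mapping.keys p \<subseteq> Poly_Mapping.keys (p * monomial u)"
    by (auto simp: in_keys_iff)
qed

definition indicator_exp :: "'v set \<Rightarrow> 'v \<Rightarrow>\<^sub>0 nat" where
  "indicator_exp A = (\<Sum>v\<in>A. Poly_Mapping.single v 1)"

lemma lookup_indicator_exp:
  "finite A \<Longrightarrow> Poly_Mapping.lookup (indicator_exp A) v = (if v \<in> A then 1 else 0)"
  by (simp add: indicator_exp_def lookup_sum lookup_single when_def)

lemma keys_indicator_exp: "finite A \<Longrightarrow> Poly_Mapping.keys (indicator_exp A) = A"
  by (auto simp: in_keys_iff lookup_indicator_exp split: if_splits)

lemma monomial_deg_indicator_exp: "finite A \<Longrightarrow> monomial_deg (indicator_exp A) = card A"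
  by (simp add: monomial_deg_def keys_indicator_exp lookup_indicator_exp)

lemma prod_Var:
  "finite A \<Longrightarrow> (\<Prod>v\<in>A. Var v :: ('v, 'k::field) mpoly) = monomial (indicator_exp A)"
  unfolding indicator_exp_def
  by (induction A rule: finite_induct) (simp_all add: Var_def monomial_def mult_single)

lemma card_keys_le_monomial_deg: "card (Poly_Mapping.keys m) \<le> monomial_deg m"
proof -
  have "(\<Sum>v\<in>Poly_Mapping.keys m. 1) \<le> monomial_deg m"
    unfolding monomial_deg_def by (rule sum_mono) (simp add: in_keys_iff Suc_le_eq)
  then show ?thesis by simp
qed

section \<open>Squarefree monomial ideals\<close>

text \<open>If the members of \<open>F\<close> are finite subsets of \<open>V\<close>, this is the ideal generated by the products of
  the variables in each member of \<open>F\<close> (lemma \<open>genideal_squarefree\<close>). Membership is decided by the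
  supports of the terms alone.\<close>

definition squarefree_ideal :: "'v set \<Rightarrow> 'v set set \<Rightarrow> ('v, 'k::field) mpoly set" where
  "squarefree_ideal V F = {p \<in> carrier (poly_ring V).
     \<forall>m \<in> Poly_Mapping.keys p. \<exists>A \<in> F. A \<subseteq> Poly_Mapping.keys m}"

lemma monomial_in_squarefree_ideal:
  "(monomial m :: ('v, 'k::field) mpoly) \<in> squarefree_ideal V F \<longleftrightarrow>
     Poly_Mapping.keys m \<subseteq> V \<and> (\<exists>A \<in> F. A \<subseteq> Poly_Mapping.keys m)"
  by (simp add: squarefree_ideal_def monomial_def poly_ring_def)

lemma squarefree_ideal_cofinal:
  assumes "\<And>A. A \<in> F \<Longrightarrow> \<exists>B \<in> G. B \<subseteq> A" "\<And>B. B \<in> G \<Longrightarrow> \<exists>A \<in> F. A \<subseteq> B"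
  shows "squarefree_ideal V F = squarefree_ideal V G"
proof -
  have "(\<exists>A\<in>F. A \<subseteq> X) \<longleftrightarrow> (\<exists>B\<in>G. B \<subseteq> X)" for X
    using assms by (metis subset_trans)
  then show ?thesis by (simp add: squarefree_ideal_def)
qed

lemma ideal_squarefree_ideal:
  "ideal (squarefree_ideal V F :: ('v, 'k::field) mpoly set) (poly_ring V)"
proof -
  let ?R = "poly_ring V :: ('v, 'k) mpoly ring" and ?I = "squarefree_ideal V F :: ('v, 'k) mpoly set"
  interpret R: cring ?R by (rule cring_poly_ring)
  have ops: "mult ?R = (*)" "one ?R = 1" "zero ?R = 0" "add ?R = (+)"
    by (simp_all add: poly_ring_def)
  have mult: "x * a \<in> ?I" if a: "a \<in> ?I" and x: "x \<in> carrier ?R" for a x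
  proof -
    have "\<exists>A\<in>F. A \<subseteq> Poly_Mapping.keys m" if m: "m \<in> Poly_Mapping.keys (x * a)" for m
    proof -
      obtain r s where "m = r + s" "r \<in> Poly_Mapping.keys x" "s \<in> Poly_Mapping.keys a"
        using keys_mult[of x a] m by blast
      moreover obtain A where "A \<in> F" "A \<subseteq> Poly_Mapping.keys s"
        using a \<open>s \<in> Poly_Mapping.keys a\<close> by (auto simp: squarefree_ideal_def)
      ultimately show ?thesis by (auto simp: keys_plus_nat)
    qed
    moreover have "x * a \<in> carrier ?R"
      using R.m_closed[of x a] a x by (simp add: ops squarefree_ideal_def)
    ultimately show ?thesis by (simp add: squarefree_ideal_def)
  qed
  have add: "a + b \<in> ?I" if "a \<in> ?I" "b \<in> ?I" for a b
  proof -
    have "a + b \<in> carrier ?R"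
      using that R.a_closed[of a b] by (simp add: ops squarefree_ideal_def)
    then show ?thesis
      using that keys_add[of a b] unfolding squarefree_ideal_def by blast
  qed
  have "subgroup ?I (add_monoid ?R)"
  proof (rule R.add.subgroupI)
    show "\<ominus>\<^bsub>?R\<^esub> a \<in> ?I" if a: "a \<in> ?I" for a
    proof -
      have "- a \<in> ?I" using a by (simp add: squarefree_ideal_def poly_ring_def)
      moreover have "- a = \<ominus>\<^bsub>?R\<^esub> a"
        using a \<open>- a \<in> ?I\<close> by (intro R.minus_equality[symmetric]) (auto simp: ops squarefree_ideal_def)
      ultimately show ?thesis by simp
    qed
    show "?I \<noteq> {}"
      by (auto simp: squarefree_ideal_def poly_ring_def intro!: exI[of _ 0])
    show "?I \<subseteq> carrier ?R" by (auto simp: squarefree_ideal_def)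
    show "a \<oplus>\<^bsub>?R\<^esub> b \<in> ?I" if "a \<in> ?I" "b \<in> ?I" for a b
      unfolding ops using that by (rule add)
  qed
  moreover have "a * x \<in> ?I" if "a \<in> ?I" "x \<in> carrier ?R" for a x
    using mult[OF that] by (simp only: mult.commute)
  ultimately show ?thesis
    using mult by (intro idealI R.ring_axioms) (simp_all only: ops)
qed

text \<open>Every term of a member of \<open>squarefree_ideal V F\<close> is divisible by a generator, and a polynomial
  is the sum of its terms.\<close>

lemma genideal_squarefree:
  assumes "\<And>A. A \<in> F \<Longrightarrow> finite A \<and> A \<subseteq> V"
  shows "Idl\<^bsub>poly_ring V\<^esub> ((\<lambda>A. monomial (indicator_exp A)) ` F)
    = (squarefree_ideal V F :: ('v, 'k::field) mpoly set)"
proof -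
  let ?R = "poly_ring V :: ('v, 'k) mpoly ring" and ?I = "squarefree_ideal V F :: ('v, 'k) mpoly set"
  let ?S = "(\<lambda>A. monomial (indicator_exp A)) ` F :: ('v, 'k) mpoly set"
  interpret R: cring ?R by (rule cring_poly_ring)
  have ops: "mult ?R = (*)" "one ?R = 1" "zero ?R = 0" "add ?R = (+)"
    by (simp_all add: poly_ring_def)
  have S: "?S \<subseteq> ?I"
    using assms by (auto simp: monomial_in_squarefree_ideal keys_indicator_exp)
  then have "?S \<subseteq> carrier ?R" by (auto simp: squarefree_ideal_def)
  then interpret J: ideal "Idl\<^bsub>?R\<^esub> ?S" ?R by (rule R.genideal_ideal)
  have "p \<in> Idl\<^bsub>?R\<^esub> ?S" if p: "p \<in> ?I" for p
  proof -
    have term_in: "Poly_Mapping.single m c \<in> Idl\<^bsub>?R\<^esub> ?S" if m: "m \<in> Poly_Mapping.keys p" for m and c :: 'k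
    proof -
      obtain A where A: "A \<in> F" "A \<subseteq> Poly_Mapping.keys m"
        using p m by (auto simp: squarefree_ideal_def)
      then have "finite A" using assms by auto
      define r where "r = m - indicator_exp A"
      have m_eq: "m = r + indicator_exp A"
      proof (rule poly_mapping_eqI)
        fix v
        show "Poly_Mapping.lookup m v = Poly_Mapping.lookup (r + indicator_exp A) v"
          using A(2) by (auto simp: r_def lookup_add lookup_minus lookup_indicator_exp[OF \<open>finite A\<close>] in_keys_iff)
      qed
      then have "Poly_Mapping.keys r \<subseteq> Poly_Mapping.keys m"
        by (metis keys_plus_nat Un_upper1)
      then have "Poly_Mapping.single r c \<in> carrier ?R"
        using p m by (auto simp: squarefree_ideal_def poly_ring_def)
      moreover have "monomial (indicator_exp A) \<in> Idl\<^bsub>?R\<^esub> ?S"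
        using R.genideal_self[OF \<open>?S \<subseteq> carrier ?R\<close>] A(1) by blast
      ultimately have "Poly_Mapping.single r c * monomial (indicator_exp A) \<in> Idl\<^bsub>?R\<^esub> ?S"
        using J.I_l_closed by (simp add: ops)
      then show ?thesis by (simp add: m_eq monomial_def mult_single)
    qed
    have "(\<Sum>m\<in>M. Poly_Mapping.single m (Poly_Mapping.lookup p m)) \<in> Idl\<^bsub>?R\<^esub> ?S"
      if "finite M" "M \<subseteq> Poly_Mapping.keys p" for M
      using that
    proof (induction M rule: finite_induct)
      case empty
      then show ?case using J.zero_closed by (simp add: ops)
    next
      case (insert m M)
      then show ?case using J.a_closed term_in by (simp add: ops)
    qed
    from this[of "Poly_Mapping.keys p"] show ?thesis
      by (simp add: sum_single_keys[symmetric])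
  qed
  moreover have "Idl\<^bsub>?R\<^esub> ?S \<subseteq> ?I"
    by (rule R.genideal_minimal[OF ideal_squarefree_ideal S])
  ultimately show ?thesis by blast
qed

text \<open>A term of \<open>p\<close> times \<open>u\<close> has the union of the two supports as its support, and \<open>A\<close> lies in this
  union iff \<open>A\<close> without the support of \<open>u\<close> lies in the support of the term.\<close>

lemma colon_squarefree_ideal:
  assumes "Poly_Mapping.keys u \<subseteq> V"
  shows "colon_ideal (poly_ring V) (squarefree_ideal V F) (monomial u)
    = (squarefree_ideal V ((\<lambda>A. A - Poly_Mapping.keys u) ` F) :: ('v, 'k::field) mpoly set)"
proof -
  let ?R = "poly_ring V :: ('v, 'k) mpoly ring"
  interpret R: cring ?R by (rule cring_poly_ring)
  have "p * monomial u \<in> carrier ?R" if "p \<in> carrier ?R" for p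
    using that assms by (auto simp: poly_ring_def keys_times_monomial keys_plus_nat)
  moreover have "mult ?R = (*)" by (simp add: poly_ring_def)
  ultimately show ?thesis
    by (auto simp: colon_ideal_def squarefree_ideal_def keys_times_monomial keys_plus_nat
        Diff_subset_conv Un_commute)
qed

text \<open>Discarding from \<open>f\<close> and \<open>g\<close> all terms that involve a variable of \<open>S\<close> changes \<open>f * g\<close> only by a
  member of the ideal. The product of the remainders involves no variable of \<open>S\<close>, so it is in the
  ideal only if it vanishes. The order on the variables serves to order the monomials, which makes
  the polynomials free of zero divisors.\<close>

lemma primeideal_variables:
  "primeideal (squarefree_ideal V ((\<lambda>s. {s}) ` S) :: ('v::linorder, 'k::field) mpoly set) (poly_ring V)"
proof (rule primeidealI)
  let ?R = "poly_ring V :: ('v, 'k) mpoly ring"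
  let ?P = "squarefree_ideal V ((\<lambda>s. {s}) ` S) :: ('v, 'k) mpoly set"
  show P: "ideal ?P ?R" by (rule ideal_squarefree_ideal)
  show "cring ?R" by (rule cring_poly_ring)
  interpret P: ideal ?P ?R by fact
  have ops: "mult ?R = (*)" "add ?R = (+)" by (simp_all add: poly_ring_def)
  have "1 \<in> carrier ?R" "1 \<notin> ?P" by (simp_all add: poly_ring_def squarefree_ideal_def)
  then show "carrier ?R \<noteq> ?P" by blast
  define away :: "('v, 'k) mpoly \<Rightarrow> bool" where
    "away p \<longleftrightarrow> (\<forall>m\<in>Poly_Mapping.keys p. Poly_Mapping.keys m \<inter> S = {})" for p
  have split: "\<exists>q r. p = q + r \<and> q \<in> ?P \<and> r \<in> carrier ?R \<and> away r" if p: "p \<in> carrier ?R" for p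
  proof -
    let ?term = "\<lambda>m. Poly_Mapping.single m (Poly_Mapping.lookup p m)"
    let ?M = "{m \<in> Poly_Mapping.keys p. Poly_Mapping.keys m \<inter> S \<noteq> {}}"
    let ?N = "{m \<in> Poly_Mapping.keys p. Poly_Mapping.keys m \<inter> S = {}}"
    have keys_sum: "Poly_Mapping.keys (sum ?term M) = M" if "M \<subseteq> Poly_Mapping.keys p" for M
      using that finite_subset[OF that finite_keys]
      by (auto simp: in_keys_iff lookup_sum lookup_single when_def split: if_splits)
    have keys_p: "?M \<union> ?N = Poly_Mapping.keys p" by auto
    have "p = sum ?term (?M \<union> ?N)" unfolding keys_p by (rule sum_single_keys)
    also have "\<dots> = sum ?term ?M + sum ?term ?N" by (rule sum.union_disjoint) auto
    finally have "p = sum ?term ?M + sum ?term ?N" .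
    moreover have "sum ?term ?M \<in> ?P"
      using p by (auto simp: squarefree_ideal_def poly_ring_def keys_sum)
    moreover have "sum ?term ?N \<in> carrier ?R" "away (sum ?term ?N)"
      using p by (auto simp: away_def poly_ring_def keys_sum)
    ultimately show ?thesis by blast
  qed
  fix f g
  assume f: "f \<in> carrier ?R" and g: "g \<in> carrier ?R" and "f \<otimes>\<^bsub>?R\<^esub> g \<in> ?P"
  then have fg: "f * g \<in> ?P" by (simp add: ops)
  obtain f1 f0 where f_eq: "f = f1 + f0" "f1 \<in> ?P" "f0 \<in> carrier ?R" "away f0" using split[OF f] by blast
  obtain g1 g0 where g_eq: "g = g1 + g0" "g1 \<in> ?P" "g0 \<in> carrier ?R" "away g0" using split[OF g] by blast
  have "f * g1 \<in> ?P" "f1 * g0 \<in> ?P"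
    using P.I_l_closed[OF g_eq(2) f] P.I_r_closed[OF f_eq(2) g_eq(3)] by (simp_all add: ops)
  then have "- (f * g1) \<in> ?P" "- (f1 * g0) \<in> ?P"
    by (simp_all add: squarefree_ideal_def poly_ring_def)
  then have "f * g + (- (f * g1) + - (f1 * g0)) \<in> ?P"
    using fg additive_subgroup.a_closed[OF P.is_additive_subgroup] by (simp only: ops)
  moreover have "f * g + (- (f * g1) + - (f1 * g0)) = f0 * g0"
    unfolding f_eq(1) g_eq(1) by (simp add: algebra_simps)
  ultimately have "f0 * g0 \<in> ?P" by simp
  moreover have "away (f0 * g0)"
    unfolding away_def
  proof
    fix m assume "m \<in> Poly_Mapping.keys (f0 * g0)"
    then obtain a b where "m = a + b" "a \<in> Poly_Mapping.keys f0" "b \<in> Poly_Mapping.keys g0"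
      using keys_mult[of f0 g0] by auto
    then show "Poly_Mapping.keys m \<inter> S = {}"
      using f_eq(4) g_eq(4) by (auto simp: away_def keys_plus_nat)
  qed
  ultimately have "Poly_Mapping.keys (f0 * g0) = {}"
    unfolding away_def squarefree_ideal_def by blast
  then have "f0 = 0 \<or> g0 = 0" by simp
  then consider "f = f1" | "g = g1" using f_eq(1) g_eq(1) by auto
  then show "f \<in> ?P \<or> g \<in> ?P" by cases (simp_all add: f_eq(2) g_eq(2))
qed

section \<open>Colon ideals as associated primes\<close>

text \<open>\<open>(I : u)\<close> is the annihilator of the class of \<open>u\<close> in \<open>R/I\<close>.\<close>

lemma colon_in_Ass_iff:
  assumes "ideal I R" "cring R" "u \<in> carrier R"
  shows "colon_ideal R I u \<in> Ass R (quot_module R I) \<longleftrightarrow> primeideal (colon_ideal R I u) R"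
proof -
  interpret I: ideal I R by fact
  interpret cring R by fact
  have "I +>\<^bsub>R\<^esub> x = I \<longleftrightarrow> x \<in> I" if "x \<in> carrier R" for x
    using that I.a_rcos_self I.a_coset_join2 I.a_rcos_const I.is_additive_subgroup by blast
  then have "colon_ideal R I u = ann R (quot_module R I) (I +>\<^bsub>R\<^esub> u)"
    using assms(3)
    by (simp add: colon_ideal_def ann_def quot_module_def FactRing_def I.rcoset_mult_add
        cong: conj_cong)
  moreover have "I +>\<^bsub>R\<^esub> u \<in> carrier (quot_module R I)"
    using assms(3) by (simp add: quot_module_def FactRing_def I.a_rcosetsI I.a_subset)
  ultimately show ?thesis by (auto simp: Ass_def)
qed

section \<open>The Helm graph\<close>

definition helm_generators :: "nat \<Rightarrow> nat set set" where
  "helm_generators n = insert {0..n} ((\<lambda>i. {i, n + i}) ` {1..n})"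

text \<open>The closed neighborhoods of the hub and of the pendants are the listed generators; the one of
  a rim vertex \<open>i\<close> contains \<open>{i, n + i}\<close>, so it contributes nothing new.\<close>

lemma CNI_helm:
  assumes "n \<ge> 1"
  shows "CNI (helm_verts n) (helm_edges n)
    = (squarefree_ideal (helm_verts n) (helm_generators n) :: (nat, 'k::field) mpoly set)"
proof -
  let ?V = "helm_verts n"
  let ?N = "closed_nbhd ?V (helm_edges n)"
  have N_sub: "?N v \<subseteq> ?V" if "v \<in> ?V" for v
    using that by (auto simp: closed_nbhd_def)
  have fin: "finite (?N v)" for v
    by (simp add: closed_nbhd_def helm_verts_def)
  have hub_edge: "{0, w} \<in> helm_edges n \<longleftrightarrow> w \<in> {1..n}" for w
    using assms by (auto simp: helm_edges_def doubleton_eq_iff)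
  have hub: "?N 0 = {0..n}"
    unfolding closed_nbhd_def hub_edge by (auto simp: helm_verts_def)
  have pendant_edge: "{n + i, w} \<in> helm_edges n \<longleftrightarrow> w = i" if "i \<in> {1..n}" for i w
    using that by (auto simp: helm_edges_def doubleton_eq_iff)
  have pendant: "?N (n + i) = {i, n + i}" if "i \<in> {1..n}" for i
    unfolding closed_nbhd_def pendant_edge[OF that] using that by (auto simp: helm_verts_def)
  have rung: "{i, n + i} \<in> helm_edges n" if "i \<in> {1..n}" for i
    using that by (auto simp: helm_edges_def)
  have rim: "{i, n + i} \<subseteq> ?N i" if "i \<in> {1..n}" for i
    using rung[OF that] that by (simp add: closed_nbhd_def helm_verts_def)
  have "{\<Prod>w\<in>?N v. Var w | v. v \<in> ?V}
    = ((\<lambda>A. monomial (indicator_exp A)) ` ?N ` ?V :: (nat, 'k) mpoly set)"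
    by (auto simp: prod_Var[OF fin])
  then have "CNI ?V (helm_edges n) = (squarefree_ideal ?V (?N ` ?V) :: (nat, 'k) mpoly set)"
    unfolding CNI_def using N_sub fin
    by (simp only:) (rule genideal_squarefree, auto)
  also have "\<dots> = squarefree_ideal ?V (helm_generators n)"
  proof (rule squarefree_ideal_cofinal)
    fix A assume "A \<in> ?N ` ?V"
    then obtain v where v: "v \<le> 2 * n" "A = ?N v" by (auto simp: helm_verts_def)
    have "v = 0 \<or> v \<in> {1..n} \<or> (\<exists>i. v = n + i \<and> i \<in> {1..n})"
      using v(1) unfolding atLeastAtMost_iff by presburger
    then consider "v = 0" | "v \<in> {1..n}" | i where "v = n + i" "i \<in> {1..n}" by blast
    then show "\<exists>B\<in>helm_generators n. B \<subseteq> A"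
    proof cases
      case 2
      then show ?thesis
        using v(2) rim[OF 2] unfolding helm_generators_def by blast
    qed (use v(2) hub pendant in \<open>auto simp: helm_generators_def\<close>)
  next
    fix B assume "B \<in> helm_generators n"
    then consider "B = ?N 0" | i where "i \<in> {1..n}" "B = ?N (n + i)"
      using hub pendant by (auto simp: helm_generators_def)
    then show "\<exists>A\<in>?N ` ?V. A \<subseteq> B"
      by cases (auto simp: helm_verts_def)
  qed
  finally show ?thesis .
qed

text \<open>Without its pendant, the rung of \<open>i\<close> is the single variable \<open>x\<^sub>i\<close>, and the remaining generator
  \<open>x\<^sub>0 \<cdots> x\<^sub>n\<close> is a multiple of \<open>x\<^sub>1\<close>. So the ideal is generated by variables.\<close>

lemma colon_pendants_prime:
  assumes "n \<ge> 1"
  shows "primeideal (squarefree_ideal (helm_verts n) ((\<lambda>A. A - {n + 1..2 * n}) ` helm_generators n)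
    :: (nat, 'k::field) mpoly set) (poly_ring (helm_verts n))"
proof -
  let ?F = "(\<lambda>A. A - {n + 1..2 * n}) ` helm_generators n" and ?S = "(\<lambda>s. {s}) ` {1..n}"
  have rung: "{i, n + i} - {n + 1..2 * n} = {i}" if "i \<in> {1..n}" for i
    using that by auto
  have "squarefree_ideal (helm_verts n) ?F = (squarefree_ideal (helm_verts n) ?S :: (nat, 'k) mpoly set)"
  proof (rule squarefree_ideal_cofinal)
    fix A assume "A \<in> ?F"
    then consider "A = {0..n} - {n + 1..2 * n}" | i where "i \<in> {1..n}" "A = {i}"
      using rung by (auto simp: helm_generators_def)
    then show "\<exists>B\<in>?S. B \<subseteq> A"
      by cases (use assms in \<open>auto intro!: bexI[of _ 1]\<close>)
  next
    fix B assume "B \<in> ?S"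
    then obtain i where i: "i \<in> {1..n}" "B = {i}" by auto
    have "{i, n + i} \<in> helm_generators n"
      using i(1) unfolding helm_generators_def by blast
    then have "B \<in> ?F"
      using rung[OF i(1)] i(2) by (metis imageI)
    then show "\<exists>A\<in>?F. A \<subseteq> B" by blast
  qed
  then show ?thesis using primeideal_variables[of "helm_verts n" "{1..n}"] by simp
qed

text \<open>\<open>U\<close> plays the support of \<open>u\<close>. Primeness yields, for every rung, an end whose addition to \<open>U\<close>
  completes a generator; properness says that \<open>U\<close> alone contains none, so this end is missing from
  \<open>U\<close> and belongs to the completed generator.\<close>

lemma card_ge_if_colon_prime:
  fixes U :: "nat set"
  assumes "finite U"
    and prime: "primeideal (squarefree_ideal (helm_verts n) ((\<lambda>A. A - U) ` helm_generators n)
      :: (nat, 'k::field) mpoly set) (poly_ring (helm_verts n))"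
  shows "n \<le> card U"
proof -
  let ?V = "helm_verts n"
  let ?R = "poly_ring ?V :: (nat, 'k) mpoly ring"
  let ?P = "squarefree_ideal ?V ((\<lambda>A. A - U) ` helm_generators n) :: (nat, 'k) mpoly set"
  interpret P: primeideal ?P ?R by (rule prime)
  have ops: "mult ?R = (*)" "one ?R = 1" by (simp_all add: poly_ring_def)
  have proper: "\<not> A \<subseteq> U" if A: "A \<in> helm_generators n" for A
  proof
    assume "A \<subseteq> U"
    then have "one ?R \<in> ?P"
      using A by (auto simp: ops squarefree_ideal_def poly_ring_def)
    then show False using P.one_imp_carrier P.I_notcarr by simp
  qed
  have Var_P: "(Var v :: (nat, 'k) mpoly) \<in> ?P \<longleftrightarrow> (\<exists>A\<in>helm_generators n. A \<subseteq> insert v U)" if "v \<in> ?V" for v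
    using that unfolding Var_def monomial_in_squarefree_ideal by (auto simp: Diff_subset_conv)
  have complete: "\<exists>v\<in>{i, n + i}. \<exists>A\<in>helm_generators n. A \<subseteq> insert v U" if i: "i \<in> {1..n}" for i
  proof -
    have V: "i \<in> ?V" "n + i \<in> ?V" using i by (auto simp: helm_verts_def)
    have gen: "{i, n + i} \<in> helm_generators n" using i by (auto simp: helm_generators_def)
    have "Var i * Var (n + i) = (monomial (indicator_exp {i, n + i}) :: (nat, 'k) mpoly)"
      using prod_Var[of "{i, n + i}"] i by simp
    also have "\<dots> \<in> ?P"
      using V gen by (auto simp: monomial_in_squarefree_ideal keys_indicator_exp
          intro!: bexI[of _ "{i, n + i}"])
    finally have "Var i * Var (n + i) \<in> ?P" .
    moreover have "(Var i :: (nat, 'k) mpoly) \<in> carrier ?R" "(Var (n + i) :: (nat, 'k) mpoly) \<in> carrier ?R"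
      using V by (simp_all add: poly_ring_def Var_def monomial_def)
    ultimately have "(Var i :: (nat, 'k) mpoly) \<in> ?P \<or> (Var (n + i) :: (nat, 'k) mpoly) \<in> ?P"
      using P.I_prime by (simp add: ops)
    then show ?thesis using Var_P V by blast
  qed
  show ?thesis
  proof (cases "\<forall>i\<in>{1..n}. i \<in> U \<or> n + i \<in> U")
    case True
    define pick where "pick i = (if i \<in> U then i else n + i)" for i
    have "inj_on pick {1..n}" by (auto simp: inj_on_def pick_def)
    moreover have "pick ` {1..n} \<subseteq> U" using True by (auto simp: pick_def)
    ultimately show ?thesis using card_inj_on_le[of pick "{1..n}" U] \<open>finite U\<close> by simp
  next
    case False
    then obtain i where i: "i \<in> {1..n}" "i \<notin> U" "n + i \<notin> U" by blast
    obtain v A where v: "v \<in> {i, n + i}" and A: "A \<in> helm_generators n" "A \<subseteq> insert v U"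
      using complete[OF i(1)] by blast
    have "v \<in> A" using proper[OF A(1)] A(2) by blast
    have "A = {0..n}"
    proof (rule ccontr)
      assume "A \<noteq> {0..n}"
      then obtain j where j: "j \<in> {1..n}" "A = {j, n + j}"
        using A(1) unfolding helm_generators_def by blast
      \<comment> \<open>The rungs are disjoint, so \<open>v \<in> A\<close> leaves only the rung of \<open>i\<close>, of which \<open>U\<close> has no element.\<close>
      have "j = i" using \<open>v \<in> A\<close> v i(1) j by auto
      then show False using A(2) v i j by auto
    qed
    then have "{0..n} - {v} \<subseteq> U" using A(2) by blast
    then have "card ({0..n} - {v}) \<le> card U" using \<open>finite U\<close> by (rule card_mono[rotated])
    then show ?thesis using \<open>v \<in> A\<close> \<open>A = {0..n}\<close> by simp
  qed
qed

theorem theorem4p7: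
  fixes n :: nat
  assumes "n \<ge> 3"
  shows "v_number (helm_verts n)
    (CNI (helm_verts n) (helm_edges n) :: (nat, 'k::field) mpoly set) = n"
proof -
  let ?V = "helm_verts n" and ?F = "helm_generators n"
  let ?R = "poly_ring ?V :: (nat, 'k) mpoly ring"
  let ?L = "CNI ?V (helm_edges n) :: (nat, 'k) mpoly set"
  have L: "?L = squarefree_ideal ?V ?F" using assms by (intro CNI_helm) simp
  have Ass_iff: "colon_ideal ?R ?L (monomial m) \<in> Ass ?R (quot_module ?R ?L) \<longleftrightarrow>
      primeideal (squarefree_ideal ?V ((\<lambda>A. A - Poly_Mapping.keys m) ` ?F)) ?R"
    if m: "Poly_Mapping.keys m \<subseteq> ?V" for m
  proof -
    have "(monomial m :: (nat, 'k) mpoly) \<in> carrier ?R"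
      using m by (simp add: poly_ring_def monomial_def)
    then show ?thesis
      unfolding L colon_squarefree_ideal[OF m, symmetric]
      by (rule colon_in_Ass_iff[OF ideal_squarefree_ideal cring_poly_ring])
  qed
  let ?D = "{monomial_deg m | m. Poly_Mapping.keys m \<subseteq> ?V \<and>
    colon_ideal ?R ?L (monomial m) \<in> Ass ?R (quot_module ?R ?L)}"
  let ?u = "indicator_exp {n + 1..2 * n}"
  have u: "Poly_Mapping.keys ?u = {n + 1..2 * n}" "monomial_deg ?u = n"
    by (simp_all add: keys_indicator_exp monomial_deg_indicator_exp)
  have u_V: "Poly_Mapping.keys ?u \<subseteq> ?V" unfolding u(1) by (auto simp: helm_verts_def)
  have "colon_ideal ?R ?L (monomial ?u) \<in> Ass ?R (quot_module ?R ?L)"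
    unfolding Ass_iff[OF u_V] u(1) using assms by (intro colon_pendants_prime) simp
  then have "n \<in> ?D" using u(2) u_V by force
  moreover have "n \<le> d" if "d \<in> ?D" for d
  proof -
    obtain m where m: "d = monomial_deg m" "Poly_Mapping.keys m \<subseteq> ?V"
        "colon_ideal ?R ?L (monomial m) \<in> Ass ?R (quot_module ?R ?L)"
      using \<open>d \<in> ?D\<close> by blast
    have "n \<le> card (Poly_Mapping.keys m)"
      using m(3) unfolding Ass_iff[OF m(2)] by (rule card_ge_if_colon_prime[OF finite_keys])
    also have "\<dots> \<le> d" unfolding m(1) by (rule card_keys_le_monomial_deg)
    finally show ?thesis .
  qed
  ultimately show ?thesis unfolding v_number_def by (rule cInf_eq_minimum)
qed

end
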